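(* For integers $n, m \geq 0$, let $cp_2(n, m)$ denote the number of partitions of $n$ into $m$ parts $\lambda_1 \leq \cdots \leq \lambda_m$ with no part equal to $2$, such that $\lambda_{i+1} - \lambda_i \geq 2$ for all $i$, and $\lambda_{i+1} - \lambda_i \geq 4$ unless $\lambda_i + \lambda_{i+1}$ is a multiple of $3$. Then \[ \sum_{m, n \geq 0} cp_2(n,m) q^n x^m = \sum_{n_1, n_2 \geq 0} \frac{ q^{6n_2^2 + 3n_2 + 2n_1^2 + n_1 + 6n_2 n_1} (1 + xq^{3n_2 + 2n_1 + 1}) x^{2n_2 + n_1} }{ (q; q)_{n_1} (q^3; q^3)_{n_2} }. \]
   Context: A partition of $n$ into $m$ parts is a non-decreasing sequence of $m$ positive integers summing to $n$. For $n \geq 0$, $(a; q)_n = \prod_{j=1}^{n} (1 - a q^{j-1})$, with the empty product equal to $1$. *)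

theory Defs
  imports "HOL-Analysis.Analysis" "HOL-Computational_Algebra.Formal_Power_Series"
begin

text \<open>
  A partition is represented by the list of its parts in non-decreasing order;
  list positions count from 0, so \<open>ps ! i\<close> is the part usually written with index \<open>i + 1\<close>.
\<close>

definition partitions_into :: "nat \<Rightarrow> nat \<Rightarrow> nat list set" where
  "partitions_into n m =
     {ps. length ps = m \<and> sorted ps \<and> (\<forall>a \<in> set ps. 0 < a) \<and> sum_list ps = n}"

definition cp2 :: "nat \<Rightarrow> nat \<Rightarrow> nat" where
  "cp2 n m = card {ps \<in> partitions_into n m.
     2 \<notin> set ps \<and>
     (\<forall>i. Suc i < m \<longrightarrow> ps ! i + 2 \<le> ps ! Suc i) \<and>
     (\<forall>i. Suc i < m \<longrightarrow> \<not> 3 dvd ps ! i + ps ! Suc i \<longrightarrow> ps ! i + 4 \<le> ps ! Suc i)}"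

lemma finite_partitions_into: "finite (partitions_into n m)"
proof (rule finite_subset)
  show "partitions_into n m \<subseteq> {ps. set ps \<subseteq> {..n} \<and> length ps = m}"
    by (auto simp: partitions_into_def member_le_sum_list)
qed (simp add: finite_lists_length_eq)

definition qpochhammer :: "'a::comm_ring_1 \<Rightarrow> 'a \<Rightarrow> nat \<Rightarrow> 'a" where
  "qpochhammer a q n = (\<Prod>j=1..n. 1 - a * q ^ (j - 1))"

text \<open>
  Formal power series in \<open>q\<close> and \<open>x\<close> are series in \<open>q\<close> whose coefficients are series in \<open>x\<close>.
  The metric on the type \<open>fps\<close> makes infinite sums here converge \<open>q\<close>-adically.
\<close>

abbreviation fps_q :: "rat fps fps" where
  "fps_q \<equiv> fps_X"

abbreviation fps_x :: "rat fps fps" where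
  "fps_x \<equiv> fps_const fps_X"

text \<open>
  \<^typ>\<open>rat fps\<close> is not a field, so division in \<^typ>\<open>rat fps fps\<close> is not covered by the library's
  field lemmas. It is genuine division for the denominators below, whose constant term is 1.
\<close>

lemma fps_fps_divide_mult_cancel:
  fixes f g :: "rat fps fps"
  assumes "fps_nth g 0 = 1"
  shows "f / g * g = f"
proof -
  have "inverse g * g = 1"
    unfolding fps_inverse_def[of g] assms fps_inverse_one
    by (rule fps_left_inverse'[of 1]) (simp_all add: assms)
  moreover have "f / g = f * inverse g"
    using assms by (intro fps_divide_unit) auto
  ultimately show ?thesis
    by (simp add: mult.assoc)
qed

lemma qpochhammer_fps_q_nth_0:
  "0 < k \<Longrightarrow> fps_nth (qpochhammer (fps_q ^ k) (fps_q ^ k) n) 0 = 1"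
  by (induction n) (simp_all add: qpochhammer_def fps_mult_nth_0)

end

theory Submission
  imports Defs
begin

text \<open>
  Let \<open>A\<^sub>k\<close> be the generating function of the partitions satisfying the two difference conditions
  with all parts at least \<open>k\<close>. Splitting off a smallest part equal to \<open>k\<close> (and, if \<open>k \<equiv> 2\<close> modulo 3,
  possibly also a following part \<open>k + 2\<close>) expresses \<open>A\<^sub>k\<close> through \<open>A\<^sub>k\<^sub>+\<^sub>1\<close>, \<open>A\<^sub>k\<^sub>+\<^sub>3\<close>, \<open>A\<^sub>k\<^sub>+\<^sub>4\<close>
  and \<open>A\<^sub>k\<^sub>+\<^sub>6\<close>, and together with \<open>A\<^sub>k = 1 + O(q\<^sup>k)\<close> this recurrence has a unique solution.
  Put \<open>S(a, b) = \<Sum> q ^ (6 n\<^sub>2\<^sup>2 + 2 n\<^sub>1\<^sup>2 + 6 n\<^sub>1 n\<^sub>2 + a n\<^sub>1 + b n\<^sub>2) x ^ (2 n\<^sub>2 + n\<^sub>1) / ((q; q)\<^sub>n\<^sub>1 (q\<^sup>3; q\<^sup>3)\<^sub>n\<^sub>2)\<close>.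
  Cancelling the last factor of one of the two denominators gives
  \<open>S(a, b) - S(a + 1, b) = x q ^ (a + 2) S(a + 4, b + 6)\<close> and
  \<open>S(a, b) - S(a, b + 3) = x\<^sup>2 q ^ (b + 6) S(a + 6, b + 12)\<close>, from which suitable \<open>S(k - 2, b)\<close>
  are seen to solve the same recurrence for \<open>k \<ge> 3\<close>. A partition without the part 2 either has all parts at
  least 3, or consists of a part 1 and parts at least 5, so the series in question is
  \<open>A\<^sub>3 + x q A\<^sub>5 = S(1, 3) + x q S(3, 6)\<close>.
\<close>

section \<open>Convergence of infinite sums of formal power series\<close>

instance fps :: (ab_group_add) topological_comm_monoid_add
proof
  fix a b :: "'a fps"
  show "((\<lambda>x. fst x + snd x) \<longlongrightarrow> a + b) (nhds a \<times>\<^sub>F nhds b)"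
  proof (rule tendsto_fpsI)
    fix n
    show "\<forall>\<^sub>F x in nhds a \<times>\<^sub>F nhds b. fps_nth (fst x + snd x) n = fps_nth (a + b) n"
      unfolding eventually_prod_filter
      using eventually_fps_nth_eq_nhds_fps[of n a] eventually_fps_nth_eq_nhds_fps[of n b]
      by fastforce
  qed
qed

text \<open>Coefficient \<open>n\<close> of a product depends only on the coefficients up to
  \<open>n\<close> of the factors, and agreement up to \<open>n\<close> holds on a neighbourhood.
  This opens \<open>has_sum_cmult_right\<close> to series.\<close>

instance fps :: (ring) topological_semigroup_mult
proof
  fix a b :: "'a fps"
  show "((\<lambda>x. fst x * snd x) \<longlongrightarrow> a * b) (nhds a \<times>\<^sub>F nhds b)"
  proof (rule tendsto_fpsI)
    fix n
    show "\<forall>\<^sub>F x in nhds a \<times>\<^sub>F nhds b. fps_nth (fst x * snd x) n = fps_nth (a * b) n"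
      unfolding eventually_prod_filter
    proof (intro exI conjI allI impI)
      show "\<forall>\<^sub>F u in nhds a. \<forall>k\<le>n. fps_nth u k = fps_nth a k"
        and "\<forall>\<^sub>F u in nhds b. \<forall>k\<le>n. fps_nth u k = fps_nth b k"
        by (rule eventually_fps_nth_eq_nhds_fps_strong)+
    qed (simp add: fps_mult_nth)
  qed
qed

text \<open>Coefficient \<open>n\<close> of a partial sum is constant as soon as the index set
  contains \<open>F n\<close>, and convergence of series is exactly this stabilisation for every
  \<open>n\<close>.\<close>

lemma has_sum_fpsI:
  fixes f :: "'i \<Rightarrow> 'a::ab_group_add fps"
  assumes "\<And>n. finite (F n) \<and> F n \<subseteq> A \<and> (\<forall>i\<in>A - F n. fps_nth (f i) n = 0)
             \<and> (\<Sum>i\<in>F n. fps_nth (f i) n) = fps_nth s n"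
  shows "(f has_sum s) A"
  unfolding has_sum_def
proof (rule tendsto_fpsI)
  fix n
  show "\<forall>\<^sub>F X in finite_subsets_at_top A. fps_nth (sum f X) n = fps_nth s n"
    unfolding eventually_finite_subsets_at_top
  proof (intro exI[of _ "F n"] conjI allI impI)
    fix Y assume Y: "finite Y \<and> F n \<subseteq> Y \<and> Y \<subseteq> A"
    then have "(\<Sum>i\<in>Y. fps_nth (f i) n) = (\<Sum>i\<in>F n. fps_nth (f i) n)"
      using assms[of n] by (intro sum.mono_neutral_right) auto
    then show "fps_nth (sum f Y) n = fps_nth s n"
      using assms[of n] by (simp add: fps_sum_nth)
  qed (use assms[of n] in auto)
qed

lemma has_sum_fps_summable:
  fixes f :: "'i \<Rightarrow> 'a::ab_group_add fps"
  assumes "\<And>n. finite {i\<in>A. fps_nth (f i) n \<noteq> 0}"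
  shows "(f has_sum infsum f A) A"
proof -
  have "(f has_sum Abs_fps (\<lambda>n. \<Sum>i | i \<in> A \<and> fps_nth (f i) n \<noteq> 0. fps_nth (f i) n)) A"
    by (rule has_sum_fpsI[where F = "\<lambda>n. {i\<in>A. fps_nth (f i) n \<noteq> 0}"]) (use assms in auto)
  from this infsumI[OF this] show ?thesis
    by simp
qed

text \<open>Partial sums have a stable coefficient \<open>n\<close> beyond some finite set
  \<open>X\<close>; enlarging \<open>X\<close> by \<open>F\<close> adds only indices outside
  \<open>F\<close> or in \<open>F\<close>, and the former contribute 0.\<close>

lemma has_sum_fps_nth:
  fixes f :: "'i \<Rightarrow> 'a::ab_group_add fps"
  assumes "(f has_sum s) A" "finite F" "F \<subseteq> A" "\<And>i. i \<in> A - F \<Longrightarrow> fps_nth (f i) n = 0"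
  shows "fps_nth s n = (\<Sum>i\<in>F. fps_nth (f i) n)"
proof -
  have "\<forall>\<^sub>F X in finite_subsets_at_top A. fps_nth (sum f X) n = fps_nth s n"
    using assms(1) unfolding has_sum_def tendsto_fps_iff by blast
  then obtain X where X: "finite X" "X \<subseteq> A"
    "\<forall>Y. finite Y \<and> X \<subseteq> Y \<and> Y \<subseteq> A \<longrightarrow> fps_nth (sum f Y) n = fps_nth s n"
    unfolding eventually_finite_subsets_at_top by (elim exE conjE)
  then have "fps_nth s n = fps_nth (sum f (X \<union> F)) n"
    using assms(2,3) by simp
  also have "\<dots> = (\<Sum>i\<in>F. fps_nth (f i) n)"
    unfolding fps_sum_nth using X(1,2) assms by (intro sum.mono_neutral_right) auto
  finally show ?thesis .
qed

text \<open>The difference of \<open>f\<close> and \<open>g\<close> lives on the range of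
  \<open>h\<close>, where it is a multiple of \<open>t\<close>. With \<open>h\<close> raising one
  summation index, this lifts the termwise difference identities below to the series.\<close>

lemma has_sum_add_reindexed:
  fixes f g t :: "'i \<Rightarrow> 'a::ring fps"
  assumes "(g has_sum s) UNIV" "(t has_sum s') UNIV" "inj h"
    and "\<And>p. f (h p) = g (h p) + c * t p" "\<And>p. p \<notin> range h \<Longrightarrow> f p = g p"
  shows "(f has_sum s + c * s') UNIV"
proof -
  have "((\<lambda>p. f (h p) - g (h p)) has_sum c * s') UNIV"
    using has_sum_cmult_right[OF assms(2), of c] assms(4) by simp
  then have "((\<lambda>p. f p - g p) has_sum c * s') (range h)"
    by (simp add: has_sum_reindex[OF assms(3)] o_def)
  then have "((\<lambda>p. f p - g p) has_sum c * s') UNIV"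
    by (rule has_sum_cong_neutral[THEN iffD1, rotated -1]) (use assms(5) in auto)
  from has_sum_add[OF assms(1) this] show ?thesis by simp
qed

subsection \<open>The double series\<close>

definition denominator :: "nat \<Rightarrow> nat \<Rightarrow> rat fps fps" where
  "denominator n1 n2 = qpochhammer fps_q fps_q n1 * qpochhammer (fps_q ^ 3) (fps_q ^ 3) n2"

definition double_exponent :: "nat \<Rightarrow> nat \<Rightarrow> nat \<Rightarrow> nat \<Rightarrow> nat" where
  "double_exponent a b n1 n2 = 6 * n2\<^sup>2 + 2 * n1\<^sup>2 + 6 * n2 * n1 + a * n1 + b * n2"

definition double_term :: "nat \<Rightarrow> nat \<Rightarrow> nat \<times> nat \<Rightarrow> rat fps fps" where
  "double_term a b = (\<lambda>(n1, n2).
     fps_q ^ double_exponent a b n1 n2 * fps_x ^ (2 * n2 + n1) / denominator n1 n2)"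

definition double_series :: "nat \<Rightarrow> nat \<Rightarrow> rat fps fps" where
  "double_series a b = infsum (double_term a b) UNIV"

lemma denominator_nth_0: "fps_nth (denominator n1 n2) 0 = 1"
  using qpochhammer_fps_q_nth_0[of 1 n1] qpochhammer_fps_q_nth_0[of 3 n2]
  by (simp add: denominator_def fps_mult_nth_0)

lemma denominator_nonzero: "denominator n1 n2 \<noteq> 0"
  using denominator_nth_0[of n1 n2] by auto

lemma divide_denominator: "f / denominator n1 n2 = f * inverse (denominator n1 n2)"
  using denominator_nth_0 by (intro fps_divide_unit) auto

lemma qpochhammer_Suc: "qpochhammer a q (Suc n) = qpochhammer a q n * (1 - a * q ^ n)"
  by (simp add: qpochhammer_def)

lemma denominator_Suc:
  "denominator (Suc n1) n2 = denominator n1 n2 * (1 - fps_q ^ Suc n1)"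
  "denominator n1 (Suc n2) = denominator n1 n2 * (1 - fps_q ^ (3 * Suc n2))"
  by (simp_all add: denominator_def qpochhammer_Suc power_add mult_ac flip: power_mult)

lemma double_term_mult_denominator:
  "double_term a b (n1, n2) * denominator n1 n2
     = fps_q ^ double_exponent a b n1 n2 * fps_x ^ (2 * n2 + n1)"
  unfolding double_term_def by (simp add: fps_fps_divide_mult_cancel denominator_nth_0)

lemma double_term_nth_eq_0:
  assumes "n < double_exponent a b n1 n2"
  shows "fps_nth (double_term a b (n1, n2)) n = 0"
  using assms by (simp add: double_term_def divide_denominator mult.assoc fps_X_power_mult_nth)

text \<open>The quadratic part of the exponent dominates both indices, so only finitely many terms
  meet a given coefficient.\<close>

lemma has_sum_double_series: "(double_term a b has_sum double_series a b) UNIV"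
  unfolding double_series_def
proof (rule has_sum_fps_summable, rule finite_subset)
  fix n
  have "n1 \<le> n \<and> n2 \<le> n" if "fps_nth (double_term a b (n1, n2)) n \<noteq> 0" for n1 n2
  proof -
    from that
    have "double_exponent a b n1 n2 \<le> n"
      using double_term_nth_eq_0 not_le by blast
    then have "2 * n1\<^sup>2 + 6 * n2\<^sup>2 \<le> n"
      by (simp add: double_exponent_def)
    moreover have "n1 \<le> n1\<^sup>2" "n2 \<le> n2\<^sup>2"
      by (simp_all add: power2_nat_le_imp_le)
    ultimately show ?thesis by linarith
  qed
  then show "{p \<in> UNIV. fps_nth (double_term a b p) n \<noteq> 0} \<subseteq> {..n} \<times> {..n}"
    by auto
qed simp

text \<open>Raising \<open>a\<close> by 1 multiplies the term by \<open>fps_q ^ Suc n1\<close>, so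
  the difference carries the factor \<open>1 - fps_q ^ Suc n1\<close> of the denominator. The shifts
  4, 6 and the constant 2 come from expanding \<open>2 * (n1 + 1)\<^sup>2\<close> and
  \<open>6 * n2 * (n1 + 1)\<close>.\<close>

lemma double_term_diff_fst:
  "double_term a b (Suc n1, n2)
     = double_term (a + 1) b (Suc n1, n2) + fps_q ^ (a + 2) * fps_x * double_term (a + 4) (b + 6) (n1, n2)"
proof -
  have e1: "double_exponent (a + 1) b (Suc n1) n2 = double_exponent a b (Suc n1) n2 + Suc n1"
   and e2: "double_exponent a b (Suc n1) n2 = a + 2 + double_exponent (a + 4) (b + 6) n1 n2"
    by (simp_all add: double_exponent_def power2_eq_square algebra_simps)
  have "double_term (a + 1) b (Suc n1, n2) * denominator (Suc n1) n2
      + fps_q ^ (a + 2) * fps_x * (double_term (a + 4) (b + 6) (n1, n2) * denominator n1 n2) * (1 - fps_q ^ Suc n1)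
      = double_term a b (Suc n1, n2) * denominator (Suc n1) n2"
    unfolding double_term_mult_denominator e1 e2 power_add
    by (simp add: algebra_simps)
  then have "(double_term (a + 1) b (Suc n1, n2)
       + fps_q ^ (a + 2) * fps_x * double_term (a + 4) (b + 6) (n1, n2)) * denominator (Suc n1) n2
      = double_term a b (Suc n1, n2) * denominator (Suc n1) n2"
    by (simp only: denominator_Suc distrib_right mult.assoc)
  then show ?thesis
    using denominator_nonzero mult_right_cancel by metis
qed

text \<open>Here the factor is \<open>1 - fps_q ^ (3 * Suc n2)\<close>, whence the step 3 in
  \<open>b\<close>; the shifts come from \<open>6 * (n2 + 1)\<^sup>2\<close> and
  \<open>6 * (n2 + 1) * n1\<close>.\<close>

lemma double_term_diff_snd:
  "double_term a b (n1, Suc n2)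
     = double_term a (b + 3) (n1, Suc n2) + fps_q ^ (b + 6) * fps_x\<^sup>2 * double_term (a + 6) (b + 12) (n1, n2)"
proof -
  have e1: "double_exponent a (b + 3) n1 (Suc n2) = double_exponent a b n1 (Suc n2) + 3 * Suc n2"
   and e2: "double_exponent a b n1 (Suc n2) = b + 6 + double_exponent (a + 6) (b + 12) n1 n2"
    by (simp_all add: double_exponent_def power2_eq_square algebra_simps)
  have "double_term a (b + 3) (n1, Suc n2) * denominator n1 (Suc n2)
      + fps_q ^ (b + 6) * fps_x\<^sup>2 * (double_term (a + 6) (b + 12) (n1, n2) * denominator n1 n2) * (1 - fps_q ^ (3 * Suc n2))
      = double_term a b (n1, Suc n2) * denominator n1 (Suc n2)"
    unfolding double_term_mult_denominator e1 e2 power_add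
    by (simp add: algebra_simps power2_eq_square)
  then have "(double_term a (b + 3) (n1, Suc n2)
       + fps_q ^ (b + 6) * fps_x\<^sup>2 * double_term (a + 6) (b + 12) (n1, n2)) * denominator n1 (Suc n2)
      = double_term a b (n1, Suc n2) * denominator n1 (Suc n2)"
    by (simp only: denominator_Suc distrib_right mult.assoc)
  then show ?thesis
    using denominator_nonzero mult_right_cancel by metis
qed

text \<open>The shifted parameters enter through equations so that the rule unifies with already
  simplified arguments such as \<open>3 * j + 5\<close>.\<close>

lemma double_series_diff_fst:
  assumes "a1 = a + 1" "a2 = a + 2" "a4 = a + 4" "b6 = b + 6"
  shows "double_series a b = double_series a1 b + fps_q ^ a2 * fps_x * double_series a4 b6"
proof -
  \<comment> \<open>Outside the range \<open>n1 = 0\<close>, where the exponent does not depend on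
    \<open>a\<close>.\<close>
  have "double_term a b p = double_term (a + 1) b p"
    if "p \<notin> range (\<lambda>(n1, n2). (Suc n1, n2))" for p
  proof (cases p)
    case (Pair n1 n2)
    with that have "n1 = 0"
      by (cases n1) (auto simp: image_iff)
    with Pair show ?thesis by (simp add: double_term_def double_exponent_def)
  qed
  then have "(double_term a b has_sum
      double_series (a + 1) b + fps_q ^ (a + 2) * fps_x * double_series (a + 4) (b + 6)) UNIV"
    by (intro has_sum_add_reindexed[where h = "\<lambda>(n1, n2). (Suc n1, n2)", OF has_sum_double_series has_sum_double_series])
       (auto intro: injI double_term_diff_fst simp: split_paired_all simp del: One_nat_def add_2_eq_Suc')
  then show ?thesis
    unfolding assms using has_sum_double_series has_sum_unique by blast
qed

lemma double_series_diff_snd: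
  assumes "a6 = a + 6" "b3 = b + 3" "b6 = b + 6" "b12 = b + 12"
  shows "double_series a b = double_series a b3 + fps_q ^ b6 * fps_x\<^sup>2 * double_series a6 b12"
proof -
  have "double_term a b p = double_term a (b + 3) p"
    if "p \<notin> range (\<lambda>(n1, n2). (n1, Suc n2))" for p
  proof (cases p)
    case (Pair n1 n2)
    with that have "n2 = 0"
      by (cases n2) (auto simp: image_iff)
    with Pair show ?thesis by (simp add: double_term_def double_exponent_def)
  qed
  then have "(double_term a b has_sum
      double_series a (b + 3) + fps_q ^ (b + 6) * fps_x\<^sup>2 * double_series (a + 6) (b + 12)) UNIV"
    by (intro has_sum_add_reindexed[where h = "\<lambda>(n1, n2). (n1, Suc n2)", OF has_sum_double_series has_sum_double_series])
       (auto intro: injI double_term_diff_snd simp: split_paired_all simp del: fps_const_power)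
  then show ?thesis
    unfolding assms using has_sum_double_series has_sum_unique by blast
qed

subsection \<open>Recurrence in the smallest part\<close>

text \<open>The first summand stands for partitions without the part \<open>k\<close>. For
  \<open>k mod 3 = 2\<close> the part \<open>k + 2\<close> may follow \<open>k\<close>; it is 1
  modulo 3, so the next part is at least \<open>k + 6\<close>.\<close>

definition smallest_part_step :: "(nat \<Rightarrow> rat fps fps) \<Rightarrow> nat \<Rightarrow> rat fps fps" where
  "smallest_part_step F k = F (k + 1) + fps_q ^ k * fps_x *
     (if k mod 3 = 0 then F (k + 3)
      else if k mod 3 = 1 then F (k + 4)
      else F (k + 4) + fps_q ^ (k + 2) * fps_x * F (k + 6))"

text \<open>The step refers only to larger \<open>k\<close> and to coefficients of index at most
  \<open>n\<close>, so iterating it ends in the range \<open>n < k\<close>, where the values are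
  prescribed.\<close>

lemma smallest_part_step_unique:
  assumes F: "\<And>k. m \<le> k \<Longrightarrow> F k = smallest_part_step F k"
    and G: "\<And>k. m \<le> k \<Longrightarrow> G k = smallest_part_step G k"
    and init: "\<And>k n. m \<le> k \<Longrightarrow> n < k \<Longrightarrow> fps_nth (F k) n = fps_nth (G k) n"
    and "m \<le> k"
  shows "F k = G k"
proof (rule fps_ext)
  fix n
  show "fps_nth (F k) n = fps_nth (G k) n"
    using \<open>m \<le> k\<close>
  proof (induction "Suc n - k" arbitrary: n k rule: less_induct)
    case less
    show ?case
    proof (cases "n < k")
      case True
      with init less.prems show ?thesis by blast
    next
      case False
      \<comment> \<open>Since \<open>k \<le> n\<close>, the truncated difference
        \<open>Suc n - k\<close> is positive and drops strictly when \<open>k\<close> grows.\<close>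
      have IH: "fps_nth (F (k + j)) i = fps_nth (G (k + j)) i" if "i \<le> n" "0 < j" for i j
        using that False less.prems by (intro less.hyps) auto
      have "fps_nth (smallest_part_step F k) n = fps_nth (smallest_part_step G k) n"
        unfolding smallest_part_step_def mult.assoc
        by (simp add: fps_X_power_mult_nth IH distrib_left del: One_nat_def add_2_eq_Suc add_2_eq_Suc')
      then show ?thesis
        using F[OF less.prems] G[OF less.prems] by simp
    qed
  qed
qed

text \<open>For \<open>k\<close> equal to \<open>3 * j + 3\<close>, \<open>3 * j + 4\<close>,
  \<open>3 * j + 5\<close> the parameters are \<open>(3 * j + 1, 6 * j + 3)\<close>,
  \<open>(3 * j + 2, 6 * j + 6)\<close>, \<open>(3 * j + 3, 6 * j + 6)\<close>. No subtraction
  truncates for \<open>3 \<le> k\<close>.\<close>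

definition double_series_from :: "nat \<Rightarrow> rat fps fps" where
  "double_series_from k = double_series (k - 2)
     (if k mod 3 = 0 then 2 * k - 3 else if k mod 3 = 1 then 2 * k - 2 else 2 * k - 4)"

lemma double_series_from_step:
  assumes "3 \<le> k"
  shows "double_series_from k = smallest_part_step double_series_from k"
proof -
  \<comment> \<open>In terms of \<open>j\<close> all parameters become sums, free of natural
    subtraction.\<close>
  define j where "j = k div 3 - 1"
  have "k = 3 * j + 3 + k mod 3"
    unfolding j_def using assms by presburger
  then consider "k = 3 * j + 3" | "k = 3 * j + 4" | "k = 3 * j + 5"
    by linarith
  then show ?thesis
  proof cases
    case 1
    have "(3 * j + 4) mod 3 = 1" by presburger
    then have from_eq: "double_series_from k = double_series (3 * j + 1) (6 * j + 3)"
      "double_series_from (k + 1) = double_series (3 * j + 2) (6 * j + 6)"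
      "double_series_from (k + 3) = double_series (3 * j + 4) (6 * j + 9)"
      by (simp_all add: 1 double_series_from_def add.commute)
    have d1: "double_series (3 * j + 1) (6 * j + 3) = double_series (3 * j + 2) (6 * j + 3)
        + fps_q ^ (3 * j + 3) * fps_x * double_series (3 * j + 5) (6 * j + 9)"
      by (rule double_series_diff_fst) simp_all
    have d2: "double_series (3 * j + 2) (6 * j + 3) = double_series (3 * j + 2) (6 * j + 6)
        + fps_q ^ (6 * j + 9) * fps_x\<^sup>2 * double_series (3 * j + 8) (6 * j + 15)"
      by (rule double_series_diff_snd) simp_all
    have d3: "double_series (3 * j + 4) (6 * j + 9) = double_series (3 * j + 5) (6 * j + 9)
        + fps_q ^ (3 * j + 6) * fps_x * double_series (3 * j + 8) (6 * j + 15)"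
      by (rule double_series_diff_fst) simp_all
    \<comment> \<open>The recurrence asks for the left side of \<open>d3\<close> where
      \<open>d1\<close> yields only its first summand. This splitting of the exponent shows that the
      \<open>fps_x\<^sup>2\<close> term of \<open>d2\<close> is exactly what is missing.\<close>
    have pow: "fps_q ^ (6 * j + 9) = fps_q ^ (3 * j + 3) * fps_q ^ (3 * j + 6)"
      by (simp flip: power_add)
    have ring: "a = e + p * x * f"
      if "a = c + p * x * d" "c = e + (p * r) * x\<^sup>2 * g" "f = d + r * x * g"
      for a c d e f g p r x :: "rat fps fps"
      unfolding that by (simp only: algebra_simps power2_eq_square)
    have "k mod 3 = 0" by (simp add: 1)
    then have "smallest_part_step double_series_from k
        = double_series_from (k + 1) + fps_q ^ k * fps_x * double_series_from (k + 3)"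
      by (simp add: smallest_part_step_def)
    then show ?thesis
      unfolding from_eq using ring[OF d1 d2[unfolded pow] d3] unfolding 1 by (rule trans[OF _ sym, rotated])
  next
    case 2
    have "(3 * j + 4) mod 3 = 1" "(3 * j + 5) mod 3 = 2" "(3 * j + 8) mod 3 = 2" by presburger+
    then have from_eq: "double_series_from k = double_series (3 * j + 2) (6 * j + 6)"
      "double_series_from (k + 1) = double_series (3 * j + 3) (6 * j + 6)"
      "double_series_from (k + 4) = double_series (3 * j + 6) (6 * j + 12)"
      and "k mod 3 = 1"
      by (simp_all add: 2 double_series_from_def add.commute)
    then have "smallest_part_step double_series_from k
        = double_series_from (k + 1) + fps_q ^ k * fps_x * double_series_from (k + 4)"
      by (simp add: smallest_part_step_def)
    moreover have "double_series (3 * j + 2) (6 * j + 6) = double_series (3 * j + 3) (6 * j + 6)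
        + fps_q ^ (3 * j + 4) * fps_x * double_series (3 * j + 6) (6 * j + 12)"
      by (rule double_series_diff_fst) simp_all
    ultimately show ?thesis
      unfolding from_eq unfolding 2 by (rule trans[OF _ sym, rotated])
  next
    case 3
    have "(3 * j + 5) mod 3 = 2" "(3 * j + 11) mod 3 = 2" by presburger+
    then have from_eq: "double_series_from k = double_series (3 * j + 3) (6 * j + 6)"
      "double_series_from (k + 1) = double_series (3 * j + 4) (6 * j + 9)"
      "double_series_from (k + 4) = double_series (3 * j + 7) (6 * j + 15)"
      "double_series_from (k + 6) = double_series (3 * j + 9) (6 * j + 18)"
      and "k mod 3 = 2"
      by (simp_all add: 3 double_series_from_def add.commute)
    then have "smallest_part_step double_series_from k = double_series_from (k + 1) + fps_q ^ k * fps_x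
        * (double_series_from (k + 4) + fps_q ^ (k + 2) * fps_x * double_series_from (k + 6))"
      by (simp add: smallest_part_step_def)
    moreover have d1: "double_series (3 * j + 3) (6 * j + 6) = double_series (3 * j + 3) (6 * j + 9)
        + fps_q ^ (6 * j + 12) * fps_x\<^sup>2 * double_series (3 * j + 9) (6 * j + 18)"
      by (rule double_series_diff_snd) simp_all
    have d2: "double_series (3 * j + 3) (6 * j + 9) = double_series (3 * j + 4) (6 * j + 9)
        + fps_q ^ (3 * j + 5) * fps_x * double_series (3 * j + 7) (6 * j + 15)"
      by (rule double_series_diff_fst) simp_all
    \<comment> \<open>The exponent is \<open>k + (k + 2)\<close>: the quadratic term of
      \<open>d1\<close> accounts for the two parts \<open>k\<close> and
      \<open>k + 2\<close>.\<close>
    have pow: "fps_q ^ (6 * j + 12) = fps_q ^ (3 * j + 5) * fps_q ^ (3 * j + 5 + 2)"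
      by (simp flip: power_add)
    have ring: "a = d + p * x * (e + r * x * c)"
      if "a = b + (p * r) * x\<^sup>2 * c" "b = d + p * x * e"
      for a b c d e p r x :: "rat fps fps"
      unfolding that by (simp only: algebra_simps power2_eq_square)
    note ring[OF d1[unfolded pow] d2]
    ultimately show ?thesis
      unfolding from_eq unfolding 3 by (rule trans[OF _ sym, rotated])
  qed
qed

text \<open>The term at \<open>(0, 0)\<close> is 1. Any other exponent is at least
  \<open>(k - 2) + 2\<close> if \<open>n1\<close> is positive and at least \<open>b + 6\<close> if
  \<open>n2\<close> is positive.\<close>

lemma double_series_from_nth_less:
  assumes "3 \<le> k" "n < k"
  shows "fps_nth (double_series_from k) n = fps_nth 1 n"
proof -
  define b where "b = (if k mod 3 = 0 then 2 * k - 3 else if k mod 3 = 1 then 2 * k - 2 else 2 * k - 4)"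
  have b: "k \<le> b + 6" using assms by (auto simp: b_def)
  have 0: "fps_nth (double_term (k - 2) b (n1, n2)) n = 0" if "0 < n1 \<or> 0 < n2" for n1 n2
  proof (rule double_term_nth_eq_0)
    have "k \<le> double_exponent (k - 2) b n1 n2"
    proof (cases n1)
      case 0
      with that obtain j where "n2 = Suc j" by (cases n2) auto
      with b show ?thesis by (simp add: double_exponent_def power2_eq_square)
    next
      case (Suc j)
      with assms show ?thesis by (simp add: double_exponent_def power2_eq_square)
    qed
    with assms show "n < double_exponent (k - 2) b n1 n2" by simp
  qed
  have "fps_nth (double_series (k - 2) b) n = (\<Sum>p\<in>{(0, 0)}. fps_nth (double_term (k - 2) b p) n)"
    by (rule has_sum_fps_nth[OF has_sum_double_series]) (auto intro: 0)
  moreover have "double_term (k - 2) b (0, 0) = 1"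
    using double_term_mult_denominator[of "k - 2" b 0 0]
    by (simp add: denominator_def qpochhammer_def double_exponent_def)
  ultimately show ?thesis
    by (simp add: double_series_from_def b_def)
qed

subsection \<open>Partitions by smallest part\<close>

definition admissible :: "nat \<Rightarrow> nat \<Rightarrow> bool" where
  "admissible a b \<longleftrightarrow> a + 2 \<le> b \<and> (\<not> 3 dvd a + b \<longrightarrow> a + 4 \<le> b)"

definition admissible_from :: "nat \<Rightarrow> nat list set" where
  "admissible_from k = {ps. successively admissible ps \<and> (ps \<noteq> [] \<longrightarrow> k \<le> hd ps)}"

definition weight :: "nat list \<Rightarrow> rat fps fps" where
  "weight ps = fps_q ^ sum_list ps * fps_x ^ length ps"

definition partition_series :: "nat \<Rightarrow> rat fps fps" where
  "partition_series k = infsum weight (admissible_from k)"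

lemma weight_Cons: "weight (k # ps) = fps_q ^ k * fps_x * weight ps"
  by (simp add: weight_def power_add)

lemma weight_nth: "fps_nth (weight ps) n = (if n = sum_list ps then fps_X ^ length ps else 0)"
  by (simp add: weight_def fps_X_power_mult_nth fps_const_power)

lemma admissible_from_ge: "ps \<in> admissible_from k \<Longrightarrow> a \<in> set ps \<Longrightarrow> k \<le> a"
proof (induction ps arbitrary: k)
  case (Cons p ps)
  then have "ps \<in> admissible_from p" "k \<le> p"
    by (auto simp: admissible_from_def successively_Cons admissible_def)
  with Cons show ?case by fastforce
qed simp

lemma Cons_mem_admissible_from:
  "p # ps \<in> admissible_from k \<longleftrightarrow>
     k \<le> p \<and> successively admissible ps \<and> (ps \<noteq> [] \<longrightarrow> admissible p (hd ps))"
  by (auto simp: admissible_from_def successively_Cons)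

lemma finite_admissible_from:
  assumes "0 < k"
  shows "finite {ps \<in> admissible_from k. sum_list ps = n}"
proof (rule finite_subset)
  show "{ps \<in> admissible_from k. sum_list ps = n} \<subseteq> {ps. set ps \<subseteq> {..n} \<and> length ps \<le> n}"
  proof safe
    fix ps assume ps: "ps \<in> admissible_from k" "n = sum_list ps"
    have "length ps \<le> sum_list ps" if "\<forall>a\<in>set ps. 0 < a" for ps :: "nat list"
      using that by (induction ps) auto
    then show "length ps \<le> sum_list ps"
      using admissible_from_ge[OF ps(1)] assms by force
  qed (simp add: member_le_sum_list)
qed (simp add: finite_lists_length_le)

lemma has_sum_partition_series:
  assumes "0 < k"
  shows "(weight has_sum partition_series k) (admissible_from k)"
  unfolding partition_series_def
proof (rule has_sum_fps_summable, rule finite_subset)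
  fix n
  show "{ps \<in> admissible_from k. fps_nth (weight ps) n \<noteq> 0} \<subseteq> {ps \<in> admissible_from k. sum_list ps = n}"
    by (auto simp: weight_nth split: if_splits)
qed (rule finite_admissible_from[OF assms])

lemma has_sum_weight_Cons:
  assumes "(weight has_sum s) A"
  shows "(weight has_sum fps_q ^ k * fps_x * s) ((#) k ` A)"
  using has_sum_cmult_right[OF assms, of "fps_q ^ k * fps_x"]
  by (subst has_sum_reindex) (auto simp: o_def weight_Cons)

text \<open>Only gaps 2 and 3 are in question, and they are decided by whether 3 divides
  \<open>2 * k + 2\<close> or \<open>2 * k + 3\<close>.\<close>

lemma admissible_iff:
  "k mod 3 = 0 \<Longrightarrow> admissible k p \<longleftrightarrow> k + 3 \<le> p"
  "k mod 3 = 1 \<Longrightarrow> admissible k p \<longleftrightarrow> k + 4 \<le> p"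
  "k mod 3 = 2 \<Longrightarrow> admissible k p \<longleftrightarrow> k + 4 \<le> p \<or> p = k + 2"
  unfolding admissible_def by presburger+

lemma admissible_from_step:
  "admissible_from k = admissible_from (k + 1) \<union> (#) k `
     (if k mod 3 = 0 then admissible_from (k + 3)
      else if k mod 3 = 1 then admissible_from (k + 4)
      else admissible_from (k + 4) \<union> (#) (k + 2) ` admissible_from (k + 6))"
  (is "_ = _ \<union> (#) k ` ?A")
proof -
  have k: "k # ps \<in> admissible_from k \<longleftrightarrow> ps \<in> ?A" for ps
  proof (cases ps)
    case Nil
    then show ?thesis by (auto simp: admissible_from_def)
  next
    case (Cons p qs)
    consider "k mod 3 = 0" | "k mod 3 = 1" | "k mod 3 = 2" by linarith
    then show ?thesis
    proof cases
      case 3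
      \<comment> \<open>This residue fixes what may follow the part \<open>k + 2\<close>, giving the
        bound \<open>k + 6\<close>.\<close>
      then have "(k + 2) mod 3 = 1" by presburger
      with 3 show ?thesis
        by (auto simp: Cons Cons_mem_admissible_from successively_Cons admissible_iff)
           (auto simp: admissible_from_def admissible_iff)
    qed (auto simp: Cons Cons_mem_admissible_from successively_Cons admissible_iff)
  qed
  show ?thesis
  proof (rule set_eqI)
    fix ps
    show "ps \<in> admissible_from k \<longleftrightarrow> ps \<in> admissible_from (k + 1) \<union> (#) k ` ?A"
    proof (cases ps)
      case Nil
      then show ?thesis by (auto simp: admissible_from_def)
    next
      case (Cons p qs)
      show ?thesis
      proof (cases "p = k")
        case True
        have "k # qs \<notin> admissible_from (k + 1)" by (simp add: Cons_mem_admissible_from)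
        then show ?thesis using k[of qs] True Cons by blast
      next
        case False
        then have "ps \<notin> (#) k ` ?A" using Cons by blast
        moreover have "ps \<in> admissible_from k \<longleftrightarrow> ps \<in> admissible_from (k + 1)"
          using False Cons by (auto simp: Cons_mem_admissible_from)
        ultimately show ?thesis by blast
      qed
    qed
  qed
qed

text \<open>Provides the disjointness needed to add the sums over the pieces of a
  decomposition.\<close>

lemma Cons_notin_admissible_from: "p < k \<Longrightarrow> admissible_from k \<inter> (#) p ` A = {}"
  by (auto simp: Cons_mem_admissible_from)

lemma partition_series_step:
  assumes "0 < k"
  shows "partition_series k = smallest_part_step partition_series k"
proof -
  have has: "(weight has_sum partition_series (k + j)) (admissible_from (k + j))" for j
    using assms by (intro has_sum_partition_series) simp
  have "(weight has_sum partition_series (k + 4) + fps_q ^ (k + 2) * fps_x * partition_series (k + 6))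
      (admissible_from (k + 4) \<union> (#) (k + 2) ` admissible_from (k + 6))"
    by (intro has_sum_Un_disjoint has_sum_weight_Cons has Cons_notin_admissible_from) simp
  then have "(weight has_sum smallest_part_step partition_series k) (admissible_from k)"
    unfolding smallest_part_step_def
    by (subst admissible_from_step, intro has_sum_Un_disjoint has_sum_weight_Cons has
      Cons_notin_admissible_from) (simp_all add: has)
  then show ?thesis
    using has_sum_partition_series[OF assms] has_sum_unique by blast
qed

lemma partition_series_nth_less:
  assumes "n < k"
  shows "fps_nth (partition_series k) n = fps_nth 1 n"
proof -
  have 0: "fps_nth (weight ps) n = 0" if "ps \<in> admissible_from k - {[]}" for ps
  proof -
    have "k \<le> hd ps" "hd ps \<in> set ps" using that by (auto simp: admissible_from_def)
    then have "k \<le> sum_list ps" using member_le_sum_list[of "hd ps" ps] by simp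
    with assms show ?thesis by (simp add: weight_nth)
  qed
  have "fps_nth (partition_series k) n = (\<Sum>ps\<in>{[]}. fps_nth (weight ps) n)"
    using assms by (intro has_sum_fps_nth[OF has_sum_partition_series] 0) (auto simp: admissible_from_def)
  then show ?thesis by (simp add: weight_def)
qed

lemma partition_series_eq_double_series_from:
  assumes "3 \<le> k"
  shows "partition_series k = double_series_from k"
proof (rule smallest_part_step_unique[where m = 3])
  show "partition_series k = smallest_part_step partition_series k" if "3 \<le> k" for k
    using that by (intro partition_series_step) simp
qed (simp_all only: assms double_series_from_step[symmetric] partition_series_nth_less double_series_from_nth_less)

section \<open>Return from admissible lists to \<open>cp2\<close>\<close>

lemma cp2_eq_card:
  "cp2 n m = card {ps \<in> admissible_from 3 \<union> (#) 1 ` admissible_from 5. sum_list ps = n \<and> length ps = m}"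
proof -
  have mem: "2 \<notin> set ps \<and> (\<forall>a\<in>set ps. 0 < a) \<and> successively admissible ps
      \<longleftrightarrow> ps \<in> admissible_from 3 \<union> (#) 1 ` admissible_from 5" for ps
  proof -
    have "(\<forall>a\<in>set ps. 0 < a) \<and> successively admissible ps \<longleftrightarrow> ps \<in> admissible_from 1"
      using admissible_from_ge[of ps 1] by (cases ps) (auto simp: admissible_from_def Suc_le_eq)
    \<comment> \<open>Two unfoldings of the decomposition, at 1 and at 2. The middle piece consists
      of the lists starting with 2 and is the one discarded.\<close>
    moreover have "admissible_from 1 = admissible_from 3
        \<union> (#) 2 ` (admissible_from 6 \<union> (#) 4 ` admissible_from 8) \<union> (#) 1 ` admissible_from 5"
      using admissible_from_step[of 1] admissible_from_step[of 2]
      by (simp del: One_nat_def add: Un_assoc)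
    moreover have "2 \<notin> set ps" if "ps \<in> admissible_from 3 \<union> (#) 1 ` admissible_from 5"
      using that admissible_from_ge[of _ 3 2] admissible_from_ge[of _ 5 2] by auto
    ultimately show ?thesis by auto
  qed
  \<comment> \<open>\<open>partitions_into\<close> asks for sorted lists; the gap conditions supply
    this.\<close>
  have sorted: "sorted ps" if "successively admissible ps" for ps
  proof -
    have "successively (\<le>) ps"
      using that by (rule successively_mono) (auto simp: admissible_def)
    then show ?thesis by (simp add: successively_conv_sorted_wrt transp_def)
  qed
  have nth: "successively admissible ps \<longleftrightarrow>
      (\<forall>i. Suc i < length ps \<longrightarrow> ps ! i + 2 \<le> ps ! Suc i) \<and>
      (\<forall>i. Suc i < length ps \<longrightarrow> \<not> 3 dvd ps ! i + ps ! Suc i \<longrightarrow> ps ! i + 4 \<le> ps ! Suc i)" for ps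
    unfolding successively_conv_nth admissible_def by blast
  show ?thesis
    unfolding cp2_def
  proof (rule arg_cong[where f = card], rule Collect_cong)
    fix ps
    show "ps \<in> partitions_into n m \<and> 2 \<notin> set ps \<and>
        (\<forall>i. Suc i < m \<longrightarrow> ps ! i + 2 \<le> ps ! Suc i) \<and>
        (\<forall>i. Suc i < m \<longrightarrow> \<not> 3 dvd ps ! i + ps ! Suc i \<longrightarrow> ps ! i + 4 \<le> ps ! Suc i)
      \<longleftrightarrow> ps \<in> admissible_from 3 \<union> (#) 1 ` admissible_from 5 \<and> sum_list ps = n \<and> length ps = m"
    proof (cases "length ps = m")
      case True
      then show ?thesis
        using mem[of ps] sorted[of ps] nth[of ps] by (simp only: partitions_into_def mem_Collect_eq) blast
    qed (simp add: partitions_into_def)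
  qed
qed

text \<open>Summability is asserted along with the equality because \<open>infsum\<close> takes the
  default value 0 on families without a sum.\<close>

theorem theorem9:
  defines "L \<equiv> \<lambda>(m, n). of_nat (cp2 n m) * fps_q ^ n * fps_x ^ m"
    and "R \<equiv> \<lambda>(n1, n2).
      fps_q ^ (6 * n2\<^sup>2 + 3 * n2 + 2 * n1\<^sup>2 + n1 + 6 * n2 * n1)
        * (1 + fps_x * fps_q ^ (3 * n2 + 2 * n1 + 1)) * fps_x ^ (2 * n2 + n1)
      / (qpochhammer fps_q fps_q n1 * qpochhammer (fps_q ^ 3) (fps_q ^ 3) n2)"
  shows "L summable_on UNIV \<and> R summable_on UNIV \<and> infsum L UNIV = infsum R UNIV"
proof -
  define A where "A = admissible_from 3 \<union> (#) 1 ` admissible_from 5"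
  \<comment> \<open>The power \<open>fps_q ^ 1\<close> is kept to match
    \<open>has_sum_weight_Cons\<close> with \<open>k = 1\<close>.\<close>
  define s where "s = partition_series 3 + fps_q ^ 1 * fps_x * partition_series 5"
  have s: "(weight has_sum s) A"
    unfolding A_def s_def
    by (intro has_sum_Un_disjoint has_sum_weight_Cons has_sum_partition_series
      Cons_notin_admissible_from) auto
  have fin: "finite {ps \<in> A. sum_list ps = n}" for n
  proof (rule finite_subset)
    show "{ps \<in> A. sum_list ps = n} \<subseteq> {ps \<in> admissible_from 1. sum_list ps = n}"
      unfolding A_def by (auto simp: admissible_from_def successively_Cons admissible_def)
  qed (rule finite_admissible_from, simp)
  have "(L has_sum s) UNIV"
  \<comment> \<open>The pairs \<open>(m, n)\<close> with \<open>m\<close> the length of some list in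
    \<open>A\<close> of sum \<open>n\<close> are the only ones to contribute to coefficient
    \<open>n\<close>; grouping these lists by length then turns \<open>cp2\<close> into a sum of
    weights.\<close>
  proof (rule has_sum_fpsI[where F = "\<lambda>n. (\<lambda>m. (m, n)) ` length ` {ps \<in> A. sum_list ps = n}"], intro conjI)
    fix n
    let ?B = "{ps \<in> A. sum_list ps = n}"
    have L: "fps_nth (L (m, n')) n = (if n' = n then of_nat (cp2 n m) * fps_X ^ m else 0)" for m n'
      by (simp add: L_def mult.assoc mult.left_commute[of "of_nat _"] fps_X_power_mult_nth
            fps_of_nat[symmetric])
    show "finite ((\<lambda>m. (m, n)) ` length ` ?B)"
      using fin by simp
    have cp2: "cp2 n m = card {ps \<in> ?B. length ps = m}" for m
      by (simp add: cp2_eq_card A_def conj_assoc)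
    show "\<forall>i\<in>UNIV - (\<lambda>m. (m, n)) ` length ` ?B. fps_nth (L i) n = 0"
    proof safe
      fix m n' assume *: "(m, n') \<notin> (\<lambda>m. (m, n)) ` length ` ?B"
      show "fps_nth (L (m, n')) n = 0"
      proof (cases "n' = n")
        case True
        with * have "{ps \<in> ?B. length ps = m} = {}" by auto
        then show ?thesis by (simp only: L cp2 card.empty) simp
      qed (simp add: L)
    qed
    have "(\<Sum>i\<in>(\<lambda>m. (m, n)) ` length ` ?B. fps_nth (L i) n)
        = (\<Sum>m\<in>length ` ?B. of_nat (card {ps \<in> ?B. length ps = m}) * fps_X ^ m)"
      by (subst sum.reindex) (auto simp: inj_on_def L cp2)
    also have "\<dots> = (\<Sum>m\<in>length ` ?B. \<Sum>ps | ps \<in> ?B \<and> length ps = m. fps_X ^ length ps)"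
      by (intro sum.cong) auto
    also have "\<dots> = (\<Sum>ps\<in>?B. fps_X ^ length ps)"
      using sum.image_gen[OF fin, of "\<lambda>ps. fps_X ^ length ps" n length] by (rule sym)
    also have "\<dots> = (\<Sum>ps\<in>?B. fps_nth (weight ps) n)"
      by (simp add: weight_nth)
    also have "\<dots> = fps_nth s n"
      by (rule has_sum_fps_nth[OF s fin, symmetric]) (auto simp: weight_nth)
    finally show "(\<Sum>i\<in>(\<lambda>m. (m, n)) ` length ` ?B. fps_nth (L i) n) = fps_nth s n" .
  qed simp
  moreover have "(R has_sum s) UNIV"
  proof -
    \<comment> \<open>Expanding the factor \<open>1 + fps_x * fps_q ^ (3 * n2 + 2 * n1 + 1)\<close>
      gives two terms; in the second, \<open>2 * n1 + 3 * n2\<close> moves the parameters from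
      \<open>(1, 3)\<close> to \<open>(3, 6)\<close> and \<open>fps_q * fps_x\<close>
      remains.\<close>
    have R: "R = (\<lambda>p. double_term 1 3 p + fps_q ^ 1 * fps_x * double_term 3 6 p)"
    proof
      fix p :: "nat \<times> nat"
      obtain n1 n2 where Pair: "p = (n1, n2)" by fastforce
      have "double_exponent 3 6 n1 n2 = double_exponent 1 3 n1 n2 + (3 * n2 + 2 * n1)"
        "6 * n2\<^sup>2 + 3 * n2 + 2 * n1\<^sup>2 + n1 + 6 * n2 * n1 = double_exponent 1 3 n1 n2"
        by (simp_all add: double_exponent_def)
      then show "R p = double_term 1 3 p + fps_q ^ 1 * fps_x * double_term 3 6 p"
        unfolding Pair R_def double_term_def prod.case denominator_def[symmetric] divide_denominator
        by (simp add: power_add algebra_simps del: fps_const_power)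
    qed
    have "(R has_sum double_series 1 3 + fps_q ^ 1 * fps_x * double_series 3 6) UNIV"
      unfolding R by (intro has_sum_add has_sum_cmult_right has_sum_double_series)
    \<comment> \<open>These are the parameters of \<open>double_series_from\<close> at 3 and at
      5.\<close>
    moreover have "s = double_series 1 3 + fps_q ^ 1 * fps_x * double_series 3 6"
      by (simp add: s_def partition_series_eq_double_series_from double_series_from_def)
    ultimately show ?thesis by simp
  qed
  ultimately show ?thesis
    using infsumI summable_on_def by metis
qed

end
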